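(* Let $G$ be an interval colorable graph. Then for all $m,n\in\mathbb{N}$, $G[K_{m,n}]$ is interval colorable, and $$w(G[K_{m,n}])\le (w(G)+1)(m+n)-1\quad\text{and}\quad W(G[K_{m,n}])\ge (W(G)+1)(m+n)-1.$$
   Context: All graphs are finite, undirected, without loops or multiple edges. $K_{m,n}$ is the complete bipartite graph with parts of sizes $m$ and $n$. A proper edge-coloring with consecutive integers $c_1,\ldots,c_t$ is an interval $t$-coloring if all $t$ colors are used and the set of colors on edges incident to each vertex is an interval of integers. A graph is interval colorable if it has an interval $t$-coloring for some positive integer $t$; $w(G)$ and $W(G)$ denote the smallest and largest such $t$. The composition $G[H]$ has vertex set $V(G)\times V(H)$, with $(u_1,v_1)(u_2,v_2)$ an edge iff $u_1u_2\in E(G)$, or $u_1=u_2$ and $v_1v_2\in E(H)$. *)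

theory Defs
  imports Complex_Main
begin

type_synonym 'a ugraph = "'a set \<times> 'a set set"

abbreviation verts :: "'a ugraph \<Rightarrow> 'a set" where "verts G \<equiv> fst G"
abbreviation edges :: "'a ugraph \<Rightarrow> 'a set set" where "edges G \<equiv> snd G"

definition simple_graph :: "'a ugraph \<Rightarrow> bool" where
  "simple_graph G \<longleftrightarrow> finite (verts G) \<and> (\<forall>e\<in>edges G. e \<subseteq> verts G \<and> card e = 2)"

definition complete_bipartite :: "nat \<Rightarrow> nat \<Rightarrow> (nat + nat) ugraph" where
  "complete_bipartite m n =
     (Inl ` {..<m} \<union> Inr ` {..<n}, {{Inl i, Inr j} | i j. i < m \<and> j < n})"

definition composition :: "'a ugraph \<Rightarrow> 'b ugraph \<Rightarrow> ('a \<times> 'b) ugraph" where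
  "composition G H =
     (verts G \<times> verts H,
      {{(u1, v1), (u2, v2)} | u1 v1 u2 v2.
         u1 \<in> verts G \<and> v1 \<in> verts H \<and> u2 \<in> verts G \<and> v2 \<in> verts H \<and>
         ({u1, u2} \<in> edges G \<or> u1 = u2 \<and> {v1, v2} \<in> edges H)})"

definition proper_edge_coloring :: "'a ugraph \<Rightarrow> ('a set \<Rightarrow> int) \<Rightarrow> bool" where
  "proper_edge_coloring G f \<longleftrightarrow>
     (\<forall>e\<in>edges G. \<forall>e'\<in>edges G. e \<noteq> e' \<and> e \<inter> e' \<noteq> {} \<longrightarrow> f e \<noteq> f e')"

definition colors_at :: "'a ugraph \<Rightarrow> ('a set \<Rightarrow> int) \<Rightarrow> 'a \<Rightarrow> int set" where
  "colors_at G f v = f ` {e \<in> edges G. v \<in> e}"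

text \<open>The colors are \<open>t\<close> consecutive integers \<open>c, \<dots>, c + t - 1\<close>, all of them used. The empty
  set is an interval (take \<open>b < a\<close>), so isolated vertices impose no condition.\<close>

definition interval_coloring :: "'a ugraph \<Rightarrow> nat \<Rightarrow> ('a set \<Rightarrow> int) \<Rightarrow> bool" where
  "interval_coloring G t f \<longleftrightarrow>
     proper_edge_coloring G f \<and>
     (\<exists>c. f ` edges G = {c..<c + int t}) \<and>
     (\<forall>v\<in>verts G. \<exists>a b. colors_at G f v = {a..b})"

definition has_interval_coloring :: "'a ugraph \<Rightarrow> nat \<Rightarrow> bool" where
  "has_interval_coloring G t \<longleftrightarrow> t > 0 \<and> (\<exists>f. interval_coloring G t f)"

definition interval_colorable :: "'a ugraph \<Rightarrow> bool" where
  "interval_colorable G \<longleftrightarrow> (\<exists>t. has_interval_coloring G t)"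

definition min_interval_colors :: "'a ugraph \<Rightarrow> nat" where
  "min_interval_colors G = (LEAST t. has_interval_coloring G t)"

definition max_interval_colors :: "'a ugraph \<Rightarrow> nat" where
  "max_interval_colors G = (GREATEST t. has_interval_coloring G t)"

lemma simple_graph_finite_edges:
  assumes "simple_graph G" shows "finite (edges G)"
  by (rule finite_subset[of _ "Pow (verts G)"]) (use assms in \<open>auto simp: simple_graph_def\<close>)

text \<open>The number of colors is bounded, so the maximum exists.\<close>

lemma has_interval_coloring_le_card:
  assumes "simple_graph G" "has_interval_coloring G t"
  shows "t \<le> card (edges G)"
proof -
  obtain f c where "f ` edges G = {c..<c + int t}"
    using assms(2) by (auto simp: has_interval_coloring_def interval_coloring_def)
  then have "card (f ` edges G) = t" by simp
  then show ?thesis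
    using card_image_le[OF simple_graph_finite_edges[OF assms(1)], of f] by simp
qed

lemma has_interval_coloring_max:
  assumes "simple_graph G" "interval_colorable G"
  shows "has_interval_coloring G (max_interval_colors G)"
  using assms GreatestI_ex_nat[of "has_interval_coloring G" "card (edges G)"]
    has_interval_coloring_le_card[of G]
  unfolding max_interval_colors_def interval_colorable_def by blast

lemma simple_graph_complete_bipartite: "simple_graph (complete_bipartite m n)"
  by (auto simp: simple_graph_def complete_bipartite_def)

lemma simple_graph_composition:
  assumes "simple_graph G" "simple_graph H"
  shows "simple_graph (composition G H)"
proof -
  have "card e = 2 \<and> e \<subseteq> verts (composition G H)" if e_edge: "e \<in> edges (composition G H)" for e
  proof -
    obtain u1 v1 u2 v2 where e: "e = {(u1, v1), (u2, v2)}"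
      and mem: "u1 \<in> verts G" "v1 \<in> verts H" "u2 \<in> verts G" "v2 \<in> verts H"
      and adj: "{u1, u2} \<in> edges G \<or> u1 = u2 \<and> {v1, v2} \<in> edges H"
      using e_edge unfolding composition_def snd_conv mem_Collect_eq by (elim exE conjE) (rule that)
    from adj have "card {u1, u2} = 2 \<or> card {v1, v2} = 2"
      using assms unfolding simple_graph_def by metis
    then have "(u1, v1) \<noteq> (u2, v2)" by auto
    then show ?thesis using e mem by (simp add: composition_def)
  qed
  moreover have "finite (verts (composition G H))"
    using assms by (simp add: composition_def simple_graph_def)
  ultimately show ?thesis by (simp add: simple_graph_def)
qed

end

theory Submission
  imports Defs
begin

text \<open>
  Let \<open>N = m + n\<close> and let \<open>f\<close> be an interval coloring of \<open>G\<close> with \<open>t\<close> colors. Give both parts of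
  \<open>K\<^bsub>m,n\<^esub>\<close> the indices \<open>0, 1, \<dots>\<close>. Over an edge \<open>uv\<close> of \<open>G\<close>, the edge \<open>(u,x)(v,y)\<close> gets the color
  \<open>f(uv) N + x + y + s(x,y)\<close>, where \<open>s\<close> is \<open>0\<close> if \<open>x, y\<close> lie in different parts, \<open>n\<close> if both lie in
  the part of size \<open>m\<close>, and \<open>m\<close> if both lie in the part of size \<open>n\<close>. For fixed \<open>x\<close> the values
  \<open>y + s(x,y)\<close> run exactly through \<open>0, \<dots>, N - 1\<close>, so the blocks belonging to consecutive colors of \<open>f\<close>
  at \<open>u\<close> are adjacent, and the colors seen at \<open>(u,x)\<close> form an interval shifted by the index of \<open>x\<close>.
  If \<open>b\<close> is the largest color of \<open>f\<close> at \<open>u\<close>, the color \<open>(b + 1) N + x + y\<close> on the edge \<open>(u,x)(u,y)\<close>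
  extends all these intervals at the upper end. The colors used are those from \<open>c N\<close> to
  \<open>(c + t) N + N - 2\<close> when \<open>f\<close> uses the colors from \<open>c\<close> to \<open>c + t - 1\<close>.
\<close>

section \<open>Edge colorings given by symmetric functions of the endpoints\<close>

text \<open>The color formula depends on the two endpoints, whereas a coloring takes an edge as a
  set. For symmetric \<open>h\<close> the chosen value does not depend on the order of the
  endpoints.\<close>

definition edge_lift :: "('a \<Rightarrow> 'a \<Rightarrow> int) \<Rightarrow> 'a set \<Rightarrow> int" where
  "edge_lift h e = (SOME k. \<exists>p q. e = {p, q} \<and> k = h p q)"

lemma edge_lift_insert:
  assumes "\<And>p q. h p q = h q p"
  shows "edge_lift h {p, q} = h p q"
proof -
  have "\<exists>p' q'. {p, q} = {p', q'} \<and> edge_lift h {p, q} = h p' q'"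
    unfolding edge_lift_def by (rule someI_ex) blast
  then show ?thesis using assms by (metis doubleton_eq_iff)
qed

lemma simple_graph_edge_at:
  assumes "simple_graph G" "e \<in> edges G" "p \<in> e"
  obtains q where "e = {p, q}" "p \<noteq> q" "p \<in> verts G" "q \<in> verts G"
proof -
  have "card e = 2" "e \<subseteq> verts G" using assms by (auto simp: simple_graph_def)
  then show thesis using assms(3) that by (auto simp: card_2_iff)
qed

lemma colors_at_edge_lift:
  assumes "simple_graph G" "\<And>p q. h p q = h q p"
  shows "colors_at G (edge_lift h) p = h p ` {q. {p, q} \<in> edges G}"
proof -
  have "\<exists>q. e = {p, q}" if "e \<in> edges G" "p \<in> e" for e
    using simple_graph_edge_at[OF assms(1) that] by metis
  then have "{e \<in> edges G. p \<in> e} = (\<lambda>q. {p, q}) ` {q. {p, q} \<in> edges G}"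
    by blast
  then show ?thesis
    using edge_lift_insert[of h, OF assms(2)] by (simp add: colors_at_def image_image)
qed

text \<open>Distinct edges that meet share an endpoint \<open>p\<close>, so it suffices to compare
  edges at one vertex.\<close>

lemma proper_edge_coloring_edge_lift:
  assumes "simple_graph G" "\<And>p q. h p q = h q p"
    and inj: "\<And>p. inj_on (h p) {q. {p, q} \<in> edges G}"
  shows "proper_edge_coloring G (edge_lift h)"
  unfolding proper_edge_coloring_def
proof (intro ballI impI, elim conjE)
  fix e e' assume e: "e \<in> edges G" "e' \<in> edges G" "e \<noteq> e'" "e \<inter> e' \<noteq> {}"
  then obtain p where "p \<in> e" "p \<in> e'" by blast
  then obtain q q' where q: "e = {p, q}" "e' = {p, q'}"
    using simple_graph_edge_at[OF assms(1)] e by metis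
  then have "h p q \<noteq> h p q'"
    using e inj[of p] by (auto dest: inj_onD)
  then show "edge_lift h e \<noteq> edge_lift h e'"
    using edge_lift_insert[of h, OF assms(2)] q by simp
qed

text \<open>Every edge has an endpoint. This computes the global color range from the intervals at
  the vertices.\<close>

lemma image_edges_eq_colors_at:
  assumes "simple_graph G"
  shows "f ` edges G = (\<Union>v\<in>verts G. colors_at G f v)"
proof -
  have "\<exists>v\<in>verts G. v \<in> e" if "e \<in> edges G" for e
  proof -
    have "card e = 2" "e \<subseteq> verts G" using assms that by (auto simp: simple_graph_def)
    then show ?thesis by (auto simp: card_2_iff)
  qed
  then show ?thesis unfolding colors_at_def by blast
qed

lemma composition_edge_iff:
  "{(u, x), (v, y)} \<in> edges (composition G H) \<longleftrightarrow>
    u \<in> verts G \<and> x \<in> verts H \<and> v \<in> verts G \<and> y \<in> verts H \<and>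
    ({u, v} \<in> edges G \<or> u = v \<and> {x, y} \<in> edges H)"
  by (auto simp: composition_def doubleton_eq_iff insert_commute)

section \<open>Offsets inside a block\<close>

definition part_index :: "nat + nat \<Rightarrow> int" where
  "part_index x = (case x of Inl i \<Rightarrow> int i | Inr j \<Rightarrow> int j)"

definition part_shift :: "nat \<Rightarrow> nat \<Rightarrow> nat + nat \<Rightarrow> nat + nat \<Rightarrow> int" where
  "part_shift m n x y = (if isl x \<noteq> isl y then 0 else if isl x then int n else int m)"

definition bipartite_degree :: "nat \<Rightarrow> nat \<Rightarrow> nat + nat \<Rightarrow> int" where
  "bipartite_degree m n x = (if isl x then int n else int m)"

lemma part_shift_commute: "part_shift m n x y = part_shift m n y x"
  by (simp add: part_shift_def)

lemma part_index_bounds: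
  assumes "x \<in> verts (complete_bipartite m n)"
  shows "0 \<le> part_index x" "part_index x + bipartite_degree m n x < int (m + n)"
  using assms by (auto simp: complete_bipartite_def part_index_def bipartite_degree_def)

text \<open>The part opposite to \<open>x\<close> supplies the initial offsets, and the part of
  \<open>x\<close> is shifted by exactly their number, so the two ranges tile
  \<open>{0..<int (m + n)}\<close>.\<close>

lemma bij_betw_part_shift:
  "bij_betw (\<lambda>y. part_index y + part_shift m n x y) (verts (complete_bipartite m n)) {0..<int (m + n)}"
proof -
  have "inj_on (\<lambda>y. part_index y + part_shift m n x y) (verts (complete_bipartite m n))"
    by (auto simp: inj_on_def complete_bipartite_def part_index_def part_shift_def
        split: if_splits sum.splits)
  moreover have "(\<lambda>y. part_index y + part_shift m n x y) ` verts (complete_bipartite m n)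
      = {0..<int (m + n)}" (is "?r ` ?V = _")
  proof (rule set_eqI, rule iffI)
    fix k assume "k \<in> ?r ` ?V"
    then show "k \<in> {0..<int (m + n)}"
      by (auto simp: complete_bipartite_def part_index_def part_shift_def)
  next
    fix k assume k: "k \<in> {0..<int (m + n)}"
    define y where "y = (if isl x then (if k < int n then Inr (nat k) else Inl (nat k - n))
      else (if k < int m then Inl (nat k) else Inr (nat k - m)))"
    have "y \<in> ?V" "?r y = k"
      using k by (auto simp: y_def complete_bipartite_def part_index_def part_shift_def)
    then show "k \<in> ?r ` ?V" by blast
  qed
  ultimately show ?thesis by (simp add: bij_betw_def)
qed

lemma bij_betw_part_index:
  assumes "x \<in> verts (complete_bipartite m n)"
  shows "bij_betw part_index {y. {x, y} \<in> edges (complete_bipartite m n)}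
    {0..<bipartite_degree m n x}"
proof (cases x)
  case (Inl i)
  have "{y. {x, y} \<in> edges (complete_bipartite m n)} = Inr ` {..<n}"
    using assms Inl by (auto simp: complete_bipartite_def doubleton_eq_iff)
  moreover have "bij_betw part_index (Inr ` {..<n}) {0..<int n}"
    by (rule bij_betw_byWitness[where f' = "Inr \<circ> nat"]) (auto simp: part_index_def)
  ultimately show ?thesis using Inl by (simp add: bipartite_degree_def)
next
  case (Inr j)
  have "{y. {x, y} \<in> edges (complete_bipartite m n)} = Inl ` {..<m}"
    using assms Inr by (auto simp: complete_bipartite_def doubleton_eq_iff)
  moreover have "bij_betw part_index (Inl ` {..<m}) {0..<int m}"
    by (rule bij_betw_byWitness[where f' = "Inl \<circ> nat"]) (auto simp: part_index_def)
  ultimately show ?thesis using Inr by (simp add: bipartite_degree_def)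
qed

lemma complete_bipartite_edge_verts:
  assumes "{x, y} \<in> edges (complete_bipartite m n)"
  shows "x \<in> verts (complete_bipartite m n)" "y \<in> verts (complete_bipartite m n)"
  using assms simple_graph_complete_bipartite[of m n] by (auto simp: simple_graph_def)

section \<open>Division into blocks\<close>

text \<open>Uniqueness of quotient and remainder: a color determines its block and its
  offset.\<close>

lemma block_eq_iff:
  fixes N :: int
  assumes "0 \<le> r" "r < N" "0 \<le> r'" "r' < N"
  shows "c * N + r = c' * N + r' \<longleftrightarrow> c = c' \<and> r = r'"
proof
  assume eq: "c * N + r = c' * N + r'"
  then have "(c * N + r) div N = (c' * N + r') div N" by simp
  moreover have "N \<noteq> 0" using assms by simp
  ultimately have "c = c'" using assms by simp
  then show "c = c' \<and> r = r'" using eq by simp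
qed simp

lemma int_le_div_iff:
  fixes N :: int
  assumes "0 < N"
  shows "a \<le> k div N \<longleftrightarrow> a * N \<le> k"
proof
  assume "a \<le> k div N"
  then have "a * N \<le> k div N * N" using assms by (simp add: mult_right_mono)
  also have "\<dots> \<le> k" using assms by (simp add: minus_mod_eq_div_mult[symmetric])
  finally show "a * N \<le> k" .
next
  assume "a * N \<le> k"
  then have "a * N div N \<le> k div N" using assms by (rule zdiv_mono1)
  then show "a \<le> k div N" using assms by simp
qed

section \<open>Colors at one vertex of the composition\<close>

definition composition_color ::
  "nat \<Rightarrow> nat \<Rightarrow> ('a set \<Rightarrow> int) \<Rightarrow> ('a \<Rightarrow> int) \<Rightarrow> 'a \<times> (nat + nat) \<Rightarrow> 'a \<times> (nat + nat) \<Rightarrow> int" where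
  "composition_color m n f b p q =
    (if fst p = fst q then (b (fst p) + 1) * int (m + n) + part_index (snd p) + part_index (snd q)
     else f {fst p, fst q} * int (m + n) + part_index (snd p) + part_index (snd q)
       + part_shift m n (snd p) (snd q))"

lemma composition_color_commute:
  "composition_color m n f b p q = composition_color m n f b q p"
  by (auto simp: composition_color_def insert_commute part_shift_commute)

text \<open>Each neighbor of \<open>u\<close> in \<open>G\<close> fills one whole block of length
  \<open>m + n\<close>, and the blocks \<open>a\<close> to \<open>b u\<close> are adjacent. The
  edges inside the copy of \<open>K\<close> over \<open>u\<close> fill the beginning of block
  \<open>b u + 1\<close>. Allowing \<open>a = b u + 1\<close> covers an isolated \<open>u\<close>,
  where only that last piece remains.\<close>

lemma bij_betw_composition_color:
  fixes G :: "'a ugraph" and m n :: nat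
  defines "K \<equiv> complete_bipartite m n"
  assumes G: "simple_graph G" and f: "proper_edge_coloring G f"
    and ab: "colors_at G f u = {a..b u}" "a \<le> b u + 1"
    and u: "u \<in> verts G" and x: "x \<in> verts K"
  shows "bij_betw (composition_color m n f b (u, x)) {q. {(u, x), q} \<in> edges (composition G K)}
    {a * int (m + n) + part_index x
      ..< (b u + 1) * int (m + n) + part_index x + bipartite_degree m n x}"
proof -
  let ?N = "int (m + n)"
  let ?h = "composition_color m n f b (u, x)"
  \<comment> \<open>Both kinds of edges are put into one form, block number \<open>blk\<close> times
    block length plus offset \<open>r\<close>; edges inside the copy over \<open>u\<close> get block
    number \<open>b u + 1\<close>.\<close>
  define r where "r = (\<lambda>v y. part_index y + (if v = u then 0 else part_shift m n x y))"
  define blk where "blk = (\<lambda>v. if v = u then b u + 1 else f {u, v})"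
  define Q where "Q = {q. {(u, x), q} \<in> edges (composition G K)}"
  have h: "?h (v, y) = part_index x + (blk v * ?N + r v y)" for v y
    by (auto simp: composition_color_def r_def blk_def)
  have loop: "{v} \<notin> edges G" for v
    using G by (auto simp: simple_graph_def)
  have Q: "(v, y) \<in> Q \<longleftrightarrow>
      (if v = u then {x, y} \<in> edges K else {u, v} \<in> edges G \<and> y \<in> verts K)" for v y
    using u x loop[of u] G complete_bipartite_edge_verts[of x y m n]
    by (auto simp: Q_def composition_edge_iff K_def simple_graph_def)
  have x_degree: "0 \<le> bipartite_degree m n x" "bipartite_degree m n x \<le> ?N"
    using part_index_bounds[OF x[unfolded K_def]] by (auto simp: bipartite_degree_def)
  have r_loop: "bij_betw (r u) {y. {x, y} \<in> edges K} {0..<bipartite_degree m n x}"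
    using bij_betw_part_index[OF x[unfolded K_def]] by (simp add: K_def r_def)
  have r_cross: "bij_betw (r v) (verts K) {0..<?N}" if "v \<noteq> u" for v
    using bij_betw_part_shift[of m n x] that by (simp add: K_def r_def)
  have r_bounds: "0 \<le> r v y" "r v y < (if v = u then bipartite_degree m n x else ?N)"
    if "(v, y) \<in> Q" for v y
  proof -
    have "r v y \<in> {0..<(if v = u then bipartite_degree m n x else ?N)}"
      using that Q[of v y] bij_betwE[OF r_loop] bij_betwE[OF r_cross[of v]]
      by (auto split: if_splits)
    then show "0 \<le> r v y" "r v y < (if v = u then bipartite_degree m n x else ?N)" by auto
  qed
  have blk_range: "blk v \<in> {a..b u}" if "(v, y) \<in> Q" "v \<noteq> u" for v y
  proof -
    have "f {u, v} \<in> colors_at G f u"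
      using that Q[of v y] by (auto simp: colors_at_def)
    then show ?thesis using that ab by (simp add: blk_def)
  qed
  have blk_inj: "v = v'" if vv: "(v, y) \<in> Q" "(v', y') \<in> Q" "blk v = blk v'" for v y v' y'
  \<comment> \<open>Block \<open>b u + 1\<close> lies above all colors of \<open>f\<close> at
    \<open>u\<close>, so it belongs to \<open>u\<close> alone; the other blocks are separated by
    properness of \<open>f\<close>.\<close>
  proof (cases "v = u \<or> v' = u")
    case True
    then show ?thesis
      using vv blk_range[of v y] blk_range[of v' y'] by (auto simp: blk_def split: if_splits)
  next
    case False
    then have "{u, v} \<in> edges G" "{u, v'} \<in> edges G" "f {u, v} = f {u, v'}"
      using vv Q by (auto simp: blk_def)
    then have "{u, v} = {u, v'}"
      using f[unfolded proper_edge_coloring_def, rule_format, of "{u, v}" "{u, v'}"] by auto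
    then show ?thesis using False by (auto simp: doubleton_eq_iff)
  qed
  have "inj_on ?h Q"
  proof (rule inj_onI, clarify)
    fix v y v' y' assume vv: "(v, y) \<in> Q" "(v', y') \<in> Q" "?h (v, y) = ?h (v', y')"
    have "r v y < ?N" "r v' y' < ?N"
      using r_bounds[OF vv(1)] r_bounds[OF vv(2)] x_degree by (auto split: if_splits)
    then have eq: "blk v = blk v'" "r v y = r v' y'"
      using vv(3) r_bounds[OF vv(1)] r_bounds[OF vv(2)] block_eq_iff[of "r v y" ?N "r v' y'"]
      by (auto simp: h)
    then have "v = v'" using blk_inj vv by blast
    moreover have "y = y'"
    proof (cases "v = u")
      case True
      then show ?thesis
        using vv eq Q \<open>v = v'\<close> bij_betw_imp_inj_on[OF r_loop] by (auto dest: inj_onD)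
    next
      case False
      then show ?thesis
        using vv eq Q \<open>v = v'\<close> bij_betw_imp_inj_on[OF r_cross[OF False]] by (auto dest: inj_onD)
    qed
    ultimately show "v = v' \<and> y = y'" by simp
  qed
  moreover have "?h ` Q = {a * ?N + part_index x
      ..< (b u + 1) * ?N + part_index x + bipartite_degree m n x}" (is "_ = ?I")
  proof (rule set_eqI, rule iffI)
    fix k assume "k \<in> ?h ` Q"
    then obtain v y where vy: "(v, y) \<in> Q" and k: "k = part_index x + (blk v * ?N + r v y)"
      by (auto simp: h)
    show "k \<in> ?I"
    proof (cases "v = u")
      case True
      have "a * ?N \<le> (b u + 1) * ?N" using ab(2) by (intro mult_right_mono) auto
      then show ?thesis
        using True r_bounds[OF vy] k by (simp add: blk_def)
    next
      case False
      have "a * ?N \<le> blk v * ?N" "(blk v + 1) * ?N \<le> (b u + 1) * ?N"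
        using blk_range[OF vy False] by (auto intro!: mult_right_mono)
      then show ?thesis
        using False r_bounds[OF vy] k x_degree by (simp add: algebra_simps)
    qed
  next
    fix k assume k: "k \<in> ?I"
    show "k \<in> ?h ` Q"
    \<comment> \<open>A color in the top block comes from the copy over \<open>u\<close>; for any
      other, the quotient is a color of \<open>f\<close> at \<open>u\<close> and the remainder picks
      \<open>y\<close>.\<close>
    proof (cases "k - part_index x \<ge> (b u + 1) * ?N")
      case True
      then have "k - part_index x - (b u + 1) * ?N \<in> {0..<bipartite_degree m n x}"
        using k by auto
      then obtain y where "{x, y} \<in> edges K" "r u y = k - part_index x - (b u + 1) * ?N"
        using r_loop unfolding bij_betw_def by (metis (no_types, lifting) imageE mem_Collect_eq)
      then have "(u, y) \<in> Q" "?h (u, y) = k" by (auto simp: Q h blk_def)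
      then show ?thesis by blast
    next
      case False
      define c where "c = (k - part_index x) div ?N"
      define d where "d = (k - part_index x) mod ?N"
      have N: "0 < ?N" using x by (auto simp: K_def complete_bipartite_def)
      have cd: "k - part_index x = c * ?N + d" "0 \<le> d" "d < ?N"
        using N by (simp_all add: c_def d_def del: of_nat_add)
      have "c < b u + 1"
        using False int_le_div_iff[OF N, of "b u + 1" "k - part_index x"] by (simp add: c_def)
      moreover have "a \<le> c"
        using k int_le_div_iff[OF N, of a "k - part_index x"] by (simp add: c_def)
      ultimately have "c \<in> colors_at G f u" using ab by simp
      then obtain e where "e \<in> edges G" "u \<in> e" "f e = c" by (auto simp: colors_at_def)
      then obtain v where v: "{u, v} \<in> edges G" "v \<noteq> u" "f {u, v} = c"
        using simple_graph_edge_at[OF G] by metis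
      have "d \<in> {0..<?N}" using cd by simp
      then obtain y where "y \<in> verts K" "r v y = d"
        using r_cross[OF v(2)] unfolding bij_betw_def by (metis imageE)
      then have "(v, y) \<in> Q" "?h (v, y) = k" using v cd by (auto simp: Q h blk_def)
      then show ?thesis by blast
    qed
  qed
  ultimately show ?thesis by (simp add: bij_betw_def Q_def)
qed

text \<open>At an isolated vertex the bound \<open>b\<close> is not determined by the coloring and is chosen inside the
  color range, so that the isolated copy of \<open>K\<^bsub>m,n\<^esub>\<close> uses no new colors.\<close>

lemma interval_coloring_bounds:
  assumes G: "simple_graph G" and "t > 0"
    and range: "f ` edges G = {c..<c + int t}"
    and ivl: "\<And>v. v \<in> verts G \<Longrightarrow> \<exists>a b. colors_at G f v = {a..b}"
  obtains a b where "\<And>v. v \<in> verts G \<Longrightarrow> colors_at G f v = {a v..b v}"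
    and "\<And>v. v \<in> verts G \<Longrightarrow> a v \<le> b v + 1"
    and "\<And>v. v \<in> verts G \<Longrightarrow> c \<le> a v"
    and "\<And>v. v \<in> verts G \<Longrightarrow> b v < c + int t"
proof -
  have "\<exists>a b. colors_at G f v = {a..b} \<and> a \<le> b + 1 \<and> c \<le> a \<and> b < c + int t"
    if v: "v \<in> verts G" for v
  proof (cases "colors_at G f v = {}")
    case True
    then show ?thesis
      \<comment> \<open>The empty interval just after the last color: the extra block over an
        isolated vertex is then block \<open>c + int t\<close>.\<close>
      using \<open>t > 0\<close> by (intro exI[of _ "c + int t"] exI[of _ "c + int t - 1"]) auto
  next
    case False
    obtain a b where ab: "colors_at G f v = {a..b}" using ivl[OF v] by blast
    then have "a \<in> colors_at G f v" "b \<in> colors_at G f v" using False by auto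
    then have "a \<in> f ` edges G" "b \<in> f ` edges G" by (auto simp: colors_at_def)
    then show ?thesis using ab False range by auto
  qed
  then show thesis using that by metis
qed

section \<open>Color range of the composition and the two bounds\<close>

lemma has_interval_coloring_composition_complete_bipartite:
  fixes G :: "'a ugraph" and m n :: nat
  assumes G: "simple_graph G" and t: "has_interval_coloring G t"
    and mn: "m \<ge> 1" "n \<ge> 1"
  shows "has_interval_coloring (composition G (complete_bipartite m n)) ((t + 1) * (m + n) - 1)"
proof -
  let ?K = "complete_bipartite m n"
  let ?C = "composition G ?K"
  let ?N = "int (m + n)"
  obtain f c where "t > 0" and f: "proper_edge_coloring G f" "f ` edges G = {c..<c + int t}"
      "\<And>v. v \<in> verts G \<Longrightarrow> \<exists>a b. colors_at G f v = {a..b}"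
    using t by (auto simp: has_interval_coloring_def interval_coloring_def)
  obtain a b where ab: "\<And>v. v \<in> verts G \<Longrightarrow> colors_at G f v = {a v..b v}"
    "\<And>v. v \<in> verts G \<Longrightarrow> a v \<le> b v + 1"
    "\<And>v. v \<in> verts G \<Longrightarrow> c \<le> a v"
    "\<And>v. v \<in> verts G \<Longrightarrow> b v < c + int t"
    using interval_coloring_bounds[OF G \<open>t > 0\<close> f(2,3)] by blast
  define h where "h = composition_color m n f b"
  define I where "I = (\<lambda>(u, x). {a u * ?N + part_index x
      ..< (b u + 1) * ?N + part_index x + bipartite_degree m n x})"
  have h_commute: "h p q = h q p" for p q
    unfolding h_def by (rule composition_color_commute)
  have C: "simple_graph ?C"
    by (rule simple_graph_composition[OF G simple_graph_complete_bipartite])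
  have verts_C: "verts ?C = verts G \<times> verts ?K" by (simp add: composition_def)
  have bij: "bij_betw (h p) {q. {p, q} \<in> edges ?C} (I p)" if "p \<in> verts ?C" for p
    using that ab bij_betw_composition_color[OF G f(1), of "fst p" "a (fst p)" b "snd p" m n]
    by (cases p) (auto simp: h_def I_def verts_C)
  have colors: "colors_at ?C (edge_lift h) p = I p" if "p \<in> verts ?C" for p
    using bij[OF that] colors_at_edge_lift[of ?C h, OF C h_commute] by (simp add: bij_betw_def)
  have "proper_edge_coloring ?C (edge_lift h)"
  proof (rule proper_edge_coloring_edge_lift[OF C h_commute])
    fix p
    show "inj_on (h p) {q. {p, q} \<in> edges ?C}"
    proof (cases "p \<in> verts ?C")
      case True
      then show ?thesis using bij bij_betw_imp_inj_on by blast
    next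
      case False
      then have "{q. {p, q} \<in> edges ?C} = {}" using C by (auto simp: simple_graph_def)
      then show ?thesis by (simp only: inj_on_empty)
    qed
  qed
  moreover have "edge_lift h ` edges ?C = {c * ?N..<(c + int t + 1) * ?N - 1}"
  proof -
    have "edge_lift h ` edges ?C = (\<Union>p\<in>verts ?C. I p)"
      using image_edges_eq_colors_at[OF C] colors by simp
    also have "\<dots> = {c * ?N..<(c + int t + 1) * ?N - 1}"
    proof (intro equalityI subsetI)
      fix k assume "k \<in> (\<Union>p\<in>verts ?C. I p)"
      then obtain u x where u: "u \<in> verts G" and x: "x \<in> verts ?K" and k: "k \<in> I (u, x)"
        by (auto simp: verts_C)
      have "c * ?N \<le> a u * ?N" "(b u + 1) * ?N \<le> (c + int t) * ?N"
        using ab(3,4)[OF u] by (auto intro!: mult_right_mono)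
      \<comment> \<open>Index plus degree is at most \<open>?N - 1\<close>, which gives the final
        \<open>- 1\<close> in the number of colors.\<close>
      then show "k \<in> {c * ?N..<(c + int t + 1) * ?N - 1}"
        using k part_index_bounds[OF x] by (auto simp: I_def algebra_simps)
    next
      fix k assume k: "k \<in> {c * ?N..<(c + int t + 1) * ?N - 1}"
      \<comment> \<open>The last block \<open>c + int t\<close> is not a color of \<open>f\<close>;
        cutting the quotient off at \<open>c + int t - 1\<close> selects a vertex \<open>u\<close>
        whose copy of \<open>?K\<close> reaches that block.\<close>
      define d where "d = min (k div ?N) (c + int t - 1)"
      have N: "0 < ?N" using mn by simp
      have "c \<le> k div ?N"
        using k int_le_div_iff[OF N] by simp
      then have "d \<in> f ` edges G"
        using f(2) \<open>t > 0\<close> by (simp add: d_def)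
      then obtain u where u: "u \<in> verts G" "d \<in> colors_at G f u"
        using image_edges_eq_colors_at[OF G] by blast
      then have d: "a u \<le> d" "d \<le> b u" using ab(1) by auto
      have N_le: "a u * ?N \<le> d * ?N" "(d + 1) * ?N \<le> (b u + 1) * ?N"
        using d by (auto intro!: mult_right_mono)
      have k_div: "k div ?N * ?N \<le> k" "k < (k div ?N + 1) * ?N"
        using N by (simp_all add: minus_mod_eq_div_mult[symmetric] distrib_right del: of_nat_add)
      have "d * ?N \<le> k div ?N * ?N" by (intro mult_right_mono) (auto simp: d_def)
      then have lower: "a u * ?N \<le> k" using N_le k_div by linarith
      show "k \<in> (\<Union>p\<in>verts ?C. I p)"
      \<comment> \<open>Two vertices over \<open>u\<close> suffice: \<open>Inl 0\<close> has the
        lowest interval of its part, ending before \<open>(b u + 1) * ?N + int n\<close>, and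
        \<open>Inl (m - 1)\<close> reaches up to \<open>(b u + 1) * ?N + ?N - 2\<close>.\<close>
      proof (cases "k < (b u + 1) * ?N + int n")
        case True
        then have "k \<in> I (u, Inl 0)"
          using lower by (simp add: I_def part_index_def bipartite_degree_def)
        moreover have "(u, Inl 0) \<in> verts ?C"
          using u mn unfolding verts_C by (auto simp: complete_bipartite_def)
        ultimately show ?thesis by blast
      next
        case False
        have "k < (b u + 1) * ?N + ?N - 1"
        proof (cases "k div ?N \<le> c + int t - 1")
          case True
          then have "k < (b u + 1) * ?N" using k_div N_le by (simp add: d_def)
          then show ?thesis using N by linarith
        next
          case False
          then have "d + 1 = c + int t" by (simp add: d_def)
          then have "(c + int t) * ?N \<le> (b u + 1) * ?N" using N_le by simp
          then show ?thesis using k by (simp add: algebra_simps)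
        qed
        \<comment> \<open>As \<open>d\<close> is a color at \<open>u\<close>, there is at least one
          full block below the extra one, so the interval of \<open>Inl (m - 1)\<close> starts low
          enough.\<close>
        moreover have "a u * ?N + ?N \<le> (b u + 1) * ?N" using N_le by (simp add: distrib_right)
        then have "a u * ?N + int (m - 1) \<le> k" using False by simp
        ultimately have "k \<in> I (u, Inl (m - 1))"
          using mn by (simp add: I_def part_index_def bipartite_degree_def)
        moreover have "(u, Inl (m - 1)) \<in> verts ?C"
          using u mn unfolding verts_C by (auto simp: complete_bipartite_def)
        ultimately show ?thesis by blast
      qed
    qed
    finally show ?thesis .
  qed
  moreover have "\<exists>l r. colors_at ?C (edge_lift h) p = {l..r}" if p: "p \<in> verts ?C" for p
  proof -
    have "{l..<r} = {l..r - 1}" for l r :: int by auto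
    then show ?thesis using colors[OF p] by (auto simp: I_def split: prod.splits)
  qed
  moreover have "c * ?N + int ((t + 1) * (m + n) - 1) = (c + int t + 1) * ?N - 1"
    using mn by (simp add: algebra_simps)
  ultimately have "interval_coloring ?C ((t + 1) * (m + n) - 1) (edge_lift h)"
    unfolding interval_coloring_def by metis
  moreover have "(t + 1) * (m + n) - 1 > 0"
    using mn by simp
  ultimately show ?thesis unfolding has_interval_coloring_def by blast
qed

theorem theorem5:
  fixes G :: "'a ugraph" and m n :: nat
  assumes "simple_graph G" and "interval_colorable G"
    and "m \<ge> 1" and "n \<ge> 1"
  shows "interval_colorable (composition G (complete_bipartite m n)) \<and>
    min_interval_colors (composition G (complete_bipartite m n))
      \<le> (min_interval_colors G + 1) * (m + n) - 1 \<and>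
    max_interval_colors (composition G (complete_bipartite m n))
      \<ge> (max_interval_colors G + 1) * (m + n) - 1"
proof -
  let ?C = "composition G (complete_bipartite m n)"
  note lift = has_interval_coloring_composition_complete_bipartite[OF assms(1) _ assms(3,4)]
  have "has_interval_coloring G (min_interval_colors G)"
    using assms(2) unfolding min_interval_colors_def interval_colorable_def by (metis LeastI)
  note min = lift[OF this]
  note max = lift[OF has_interval_coloring_max[OF assms(1,2)]]
  have "simple_graph ?C"
    by (rule simple_graph_composition[OF assms(1) simple_graph_complete_bipartite])
  \<comment> \<open>The greatest number of colors is attained because the number of edges of
    \<open>?C\<close> bounds it.\<close>
  then have "(max_interval_colors G + 1) * (m + n) - 1 \<le> max_interval_colors ?C"
    unfolding max_interval_colors_def[of ?C]
    using max has_interval_coloring_le_card by (intro Greatest_le_nat) blast+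
  moreover have "min_interval_colors ?C \<le> (min_interval_colors G + 1) * (m + n) - 1"
    unfolding min_interval_colors_def[of ?C] using min by (rule Least_le)
  ultimately show ?thesis
    using min unfolding interval_colorable_def by blast
qed

end
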